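(* Let $\kappa$ be a cardinal and let $P:=[\kappa]^{<\omega}+1$ be the poset of finite subsets of $\kappa$ ordered by inclusion with a largest element added. Then: (i) $P$ has CFPP; (ii) $P$ has CSP if and only if $\kappa\le 2$; (iii) $P$ does not have CCSP if $\kappa$ is uncountable; (iv) $\mathcal{C}(P)$ has the fixed point property if and only if $\kappa<\omega$.
   Context: For a poset $P$, $\mathcal{C}(P)$ is the set of nonempty convex subsets of $P$ ordered by the bi-dominating order: $X\le Y$ iff every element of $X$ is below some element of $Y$ and every element of $Y$ is above some element of $X$. $P$ has CFPP if every order preserving $f:P\to\mathcal{C}(P)$ has some $x$ with $x\in f(x)$. $P$ has CSP (selection property for convex subsets) if there is an order preserving map $s:\mathcal{C}(P)\to P$ with $s(S)\in S$ for every $S\in\mathcal{C}(P)$. $P$ has CCSP if for every chain $\mathcal{C}$ in $\mathcal{C}(P)$ there is an order preserving map $s:\mathcal{C}\to P$ with $s(S)\in S$ for all $S\in\mathcal{C}$. A poset has the fixed point property if every order preserving self-map has a fixed point. *)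

theory Defs
  imports "HOL-Library.Lattice_Constructions" "HOL-Library.FuncSet"
begin

unbundle cardinal_syntax

text \<open>
  A poset is given by a carrier \<open>P\<close> and an order relation \<open>le\<close>, of which only the
  restriction to \<open>P\<close> matters.
\<close>

definition convex_subsets :: "'p set \<Rightarrow> ('p \<Rightarrow> 'p \<Rightarrow> bool) \<Rightarrow> 'p set set" where
  "convex_subsets P le =
     {S. S \<noteq> {} \<and> S \<subseteq> P \<and> (\<forall>x\<in>S. \<forall>z\<in>S. \<forall>y\<in>P. le x y \<and> le y z \<longrightarrow> y \<in> S)}"

definition bi_dominates :: "('p \<Rightarrow> 'p \<Rightarrow> bool) \<Rightarrow> 'p set \<Rightarrow> 'p set \<Rightarrow> bool" where
  "bi_dominates le X Y \<longleftrightarrow> (\<forall>x\<in>X. \<exists>y\<in>Y. le x y) \<and> (\<forall>y\<in>Y. \<exists>x\<in>X. le x y)"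

definition FPP :: "'p set \<Rightarrow> ('p \<Rightarrow> 'p \<Rightarrow> bool) \<Rightarrow> bool" where
  "FPP P le \<longleftrightarrow> (\<forall>f. f \<in> P \<rightarrow> P \<and> monotone_on P le le f \<longrightarrow> (\<exists>x\<in>P. f x = x))"

definition CFPP :: "'p set \<Rightarrow> ('p \<Rightarrow> 'p \<Rightarrow> bool) \<Rightarrow> bool" where
  "CFPP P le \<longleftrightarrow>
     (\<forall>f. f \<in> P \<rightarrow> convex_subsets P le \<and> monotone_on P le (bi_dominates le) f
       \<longrightarrow> (\<exists>x\<in>P. x \<in> f x))"

text \<open>The values of a selection lie in \<open>P\<close> because the sets selected from are subsets of \<open>P\<close>.\<close>

definition monotone_selection :: "('p \<Rightarrow> 'p \<Rightarrow> bool) \<Rightarrow> 'p set set \<Rightarrow> ('p set \<Rightarrow> 'p) \<Rightarrow> bool" where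
  "monotone_selection le \<S> s \<longleftrightarrow> monotone_on \<S> (bi_dominates le) le s \<and> (\<forall>S\<in>\<S>. s S \<in> S)"

definition CSP :: "'p set \<Rightarrow> ('p \<Rightarrow> 'p \<Rightarrow> bool) \<Rightarrow> bool" where
  "CSP P le \<longleftrightarrow> (\<exists>s. monotone_selection le (convex_subsets P le) s)"

definition CCSP :: "'p set \<Rightarrow> ('p \<Rightarrow> 'p \<Rightarrow> bool) \<Rightarrow> bool" where
  "CCSP P le \<longleftrightarrow>
     (\<forall>\<C>. \<C> \<subseteq> convex_subsets P le \<and> Complete_Partial_Order.chain (bi_dominates le) \<C>
       \<longrightarrow> (\<exists>s. monotone_selection le \<C> s))"

text \<open>
  A cardinal \<open>\<kappa>\<close> is a cardinal order, whose field plays the role of the set \<open>\<kappa>\<close>.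
  The order on the type \<open>'a set top\<close> is inclusion on \<open>Value\<close>s, with \<open>Top\<close> above everything.
\<close>

definition finite_subsets_top :: "'a rel \<Rightarrow> 'a set top set" where
  "finite_subsets_top \<kappa> = insert top.Top (top.Value ` Fpow (Field \<kappa>))"

end

theory Submission
  imports Defs "HOL-Library.Countable_Set_Type"
begin

section \<open>Convex subsets and the bi-dominating order\<close>

lemma convex_subsetsI:
  assumes "S \<noteq> {}" "S \<subseteq> P"
    and "\<And>x y z. x \<in> S \<Longrightarrow> z \<in> S \<Longrightarrow> y \<in> P \<Longrightarrow> le x y \<Longrightarrow> le y z \<Longrightarrow> y \<in> S"
  shows "S \<in> convex_subsets P le"
  using assms unfolding convex_subsets_def by blast

lemma convex_subsetsD:
  assumes "S \<in> convex_subsets P le"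
  shows "S \<noteq> {}" "S \<subseteq> P"
    and "\<And>x y z. x \<in> S \<Longrightarrow> z \<in> S \<Longrightarrow> y \<in> P \<Longrightarrow> le x y \<Longrightarrow> le y z \<Longrightarrow> y \<in> S"
  using assms unfolding convex_subsets_def by blast+

lemma bi_dominates_refl: "bi_dominates (\<le>) X (X :: 'p :: order set)"
  unfolding bi_dominates_def by blast

lemma bi_dominates_trans:
  fixes X Y Z :: "'p :: order set"
  assumes "bi_dominates (\<le>) X Y" "bi_dominates (\<le>) Y Z"
  shows "bi_dominates (\<le>) X Z"
  using assms unfolding bi_dominates_def by (meson order_trans)

text \<open>Each element of \<open>Y\<close> is squeezed between two elements of \<open>X\<close>,
  so convexity of \<open>X\<close> captures it. Used in both directions, this makes bi-domination
  antisymmetric on convex sets.\<close>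

lemma bi_dominates_convex_subset:
  fixes X Y :: "'p :: order set"
  assumes "X \<in> convex_subsets P (\<le>)" "Y \<subseteq> P"
    and "bi_dominates (\<le>) X Y" "bi_dominates (\<le>) Y X"
  shows "Y \<subseteq> X"
proof
  fix y assume "y \<in> Y"
  then obtain x x' where "x \<in> X" "x \<le> y" "x' \<in> X" "y \<le> x'"
    using assms(3,4) unfolding bi_dominates_def by blast
  then show "y \<in> X"
    using convex_subsetsD(3)[OF assms(1)] \<open>y \<in> Y\<close> assms(2) by blast
qed

lemma bi_dominates_antisym:
  fixes X Y :: "'p :: order set"
  assumes "X \<in> convex_subsets P (\<le>)" "Y \<in> convex_subsets P (\<le>)"
    and "bi_dominates (\<le>) X Y" "bi_dominates (\<le>) Y X"
  shows "X = Y"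
  using bi_dominates_convex_subset[of X P Y] bi_dominates_convex_subset[of Y P X] assms
  by (blast dest: convex_subsetsD(2))

text \<open>
  A point \<open>x\<close> that is minimal among those above some element \<open>y\<close> of \<open>f x\<close> satisfies \<open>x = y\<close>:
  since \<open>f y\<close> is dominated by \<open>f x\<close>, the point \<open>y\<close> is again above some element of \<open>f y\<close>.
\<close>

lemma CFPP_if_wfp_on:
  fixes P :: "'p :: order set"
  assumes wf: "wfp_on P (<)" and t: "t \<in> P" "\<And>x. x \<in> P \<Longrightarrow> x \<le> t"
  shows "CFPP P (\<le>)"
  unfolding CFPP_def
proof (intro allI impI, elim conjE)
  fix f assume f: "f \<in> P \<rightarrow> convex_subsets P (\<le>)" and mono: "monotone_on P (\<le>) (bi_dominates (\<le>)) f"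
  define A where "A = {x \<in> P. \<exists>y\<in>f x. y \<le> x}"
  have fP: "f x \<noteq> {}" "f x \<subseteq> P" if "x \<in> P" for x
    using f that by (auto dest: convex_subsetsD)
  \<comment> \<open>The top element makes \<open>A\<close> nonempty: everything in
    \<open>f t\<close> is below \<open>t\<close>.\<close>
  have "t \<in> A"
    using fP[of t] t unfolding A_def by blast
  moreover have "A \<subseteq> P"
    unfolding A_def by blast
  ultimately obtain x where x: "x \<in> A" and min: "\<And>z. z < x \<Longrightarrow> z \<notin> A"
    using wf unfolding wfp_on_iff_ex_minimal by (metis empty_iff)
  then obtain y where y: "x \<in> P" "y \<in> f x" "y \<le> x"
    unfolding A_def by blast
  then have "y \<in> P"
    using fP by blast
  then have "bi_dominates (\<le>) (f y) (f x)"
    using mono y by (blast dest: monotone_onD)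
  then have "y \<in> A"
    using y \<open>y \<in> P\<close> unfolding A_def bi_dominates_def by blast
  then have "y = x"
    using min y(3) by (auto simp: order_le_less)
  then show "\<exists>x\<in>P. x \<in> f x"
    using y by blast
qed

section \<open>Criteria for and against the fixed point property\<close>

text \<open>Among the points with \<open>le x (f x)\<close>, of which \<open>b\<close> is one, take
  one with the fewest points above it; \<open>f x\<close> is again such a point and cannot lie
  strictly higher. The order laws are required on \<open>P\<close> only, since bi-domination is
  antisymmetric just on convex sets.\<close>

lemma FPP_if_finite_bot:
  assumes "finite P" and refl: "\<And>x. x \<in> P \<Longrightarrow> le x x"
    and trans: "\<And>x y z. x \<in> P \<Longrightarrow> y \<in> P \<Longrightarrow> z \<in> P \<Longrightarrow> le x y \<Longrightarrow> le y z \<Longrightarrow> le x z"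
    and antisym: "\<And>x y. x \<in> P \<Longrightarrow> y \<in> P \<Longrightarrow> le x y \<Longrightarrow> le y x \<Longrightarrow> x = y"
    and b: "b \<in> P" "\<And>x. x \<in> P \<Longrightarrow> le b x"
  shows "FPP P le"
  unfolding FPP_def
proof (intro allI impI, elim conjE)
  fix f assume f: "f \<in> P \<rightarrow> P" and mono: "monotone_on P le le f"
  let ?U = "\<lambda>x. {y \<in> P. le x y}"
  have "b \<in> P \<and> le b (f b)"
    using b f by blast
  from ex_has_least_nat[where P = "\<lambda>x. x \<in> P \<and> le x (f x)" and m = "\<lambda>x. card (?U x)", OF this]
  obtain x where x: "x \<in> P" "le x (f x)"
    and least: "\<And>y. y \<in> P \<Longrightarrow> le y (f y) \<Longrightarrow> card (?U x) \<le> card (?U y)"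
    by blast
  have fx: "f x \<in> P"
    using f x by blast
  then have "le (f x) (f (f x))"
    using mono x by (blast dest: monotone_onD)
  moreover have "?U (f x) \<subseteq> ?U x"
    using trans x fx by blast
  \<comment> \<open>Minimality of the cardinality turns the inclusion into an equality; then
    \<open>x\<close>, being in its own up-set, is above \<open>f x\<close>.\<close>
  ultimately have "?U (f x) = ?U x"
    using \<open>finite P\<close> least fx by (simp add: card_seteq)
  then have "le (f x) x"
    using refl x by blast
  then show "\<exists>x\<in>P. f x = x"
    using antisym x fx by blast
qed

text \<open>
  The map sends a point \<open>z\<close> that is not above all \<open>X n\<close> to the first \<open>X n\<close> not below it, and
  every other \<open>z\<close> to the first \<open>Y m\<close> not above it.
\<close>

lemma not_FPP_if_gap:
  fixes X Y :: "nat \<Rightarrow> 'p"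
  assumes refl: "\<And>x. x \<in> P \<Longrightarrow> le x x"
    and trans: "\<And>x y z. x \<in> P \<Longrightarrow> y \<in> P \<Longrightarrow> z \<in> P \<Longrightarrow> le x y \<Longrightarrow> le y z \<Longrightarrow> le x z"
    and XP: "\<And>n. X n \<in> P" and YP: "\<And>n. Y n \<in> P"
    and X: "\<And>m n. m \<le> n \<Longrightarrow> le (X m) (X n)" and Y: "\<And>m n. m \<le> n \<Longrightarrow> le (Y n) (Y m)"
    and XY: "\<And>m n. le (X m) (Y n)"
    and gap: "\<And>z. z \<in> P \<Longrightarrow> (\<And>n. le (X n) z) \<Longrightarrow> (\<And>n. le z (Y n)) \<Longrightarrow> False"
  shows "\<not> FPP P le"
proof -
  define f where "f z = (if \<forall>n. le (X n) z then Y (LEAST n. \<not> le z (Y n))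
    else X (LEAST n. \<not> le (X n) z))" for z
  \<comment> \<open>Here the gap guarantees that the \<open>LEAST\<close> is attained. By
    \<open>up\<close> and \<open>lo\<close>, \<open>z\<close> is not below \<open>f z\<close> in the
    first case and \<open>f z\<close> is not below \<open>z\<close> in the second, so reflexivity
    excludes \<open>f z = z\<close>.\<close>
  have up: "\<not> le z (Y (LEAST n. \<not> le z (Y n)))" if "z \<in> P" "\<forall>n. le (X n) z" for z
    using gap that by (metis (mono_tags, lifting) LeastI)
  have lo: "\<not> le (X (LEAST n. \<not> le (X n) z)) z" if "\<not> (\<forall>n. le (X n) z)" for z
    using that by (metis (mono_tags, lifting) LeastI)
  have "f z \<noteq> z" if "z \<in> P" for z
    using up[OF that] lo[of z] refl[OF that] unfolding f_def by (metis (full_types))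
  moreover have "f \<in> P \<rightarrow> P"
    using XP YP unfolding f_def by simp
  moreover have "monotone_on P le le f"
  proof (rule monotone_onI)
    fix z w assume zw: "z \<in> P" "w \<in> P" "le z w"
    have below: "le (X n) w" if "le (X n) z" for n
      using trans[OF XP zw(1,2)] that zw(3) by blast
    have above: "le z (Y n)" if "le w (Y n)" for n
      using trans[OF zw(1,2) YP] that zw(3) by blast
    show "le (f z) (f w)"
    proof (cases "\<forall>n. le (X n) w")
      case w: True
      show ?thesis
      proof (cases "\<forall>n. le (X n) z")
        case True
        \<comment> \<open>A larger point leaves the decreasing sequence \<open>Y\<close> no later,
          so its value under \<open>f\<close> is no smaller. The last case is dual, with
          \<open>X\<close>.\<close>
        then have "(LEAST n. \<not> le w (Y n)) \<le> (LEAST n. \<not> le z (Y n))"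
          using up[OF zw(1)] above by (blast intro: Least_le)
        then show ?thesis
          using True w Y by (simp add: f_def)
      next
        case False
        then show ?thesis
          using w XY by (auto simp: f_def)
      qed
    next
      case w: False
      then have z: "\<not> (\<forall>n. le (X n) z)"
        using below by blast
      have "(LEAST n. \<not> le (X n) z) \<le> (LEAST n. \<not> le (X n) w)"
        using lo[OF w] below by (blast intro: Least_le)
      moreover have "f z = X (LEAST n. \<not> le (X n) z)" "f w = X (LEAST n. \<not> le (X n) w)"
        using w z unfolding f_def by (simp_all only: if_False)
      ultimately show ?thesis
        using X by simp
    qed
  qed
  ultimately show ?thesis
    unfolding FPP_def by blast
qed

section \<open>The poset of finite subsets with a top element, and CFPP\<close>

lemma Value_in_finite_subsets_top [simp]:
  "top.Value F \<in> finite_subsets_top \<kappa> \<longleftrightarrow> finite F \<and> F \<subseteq> Field \<kappa>"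
  by (auto simp: finite_subsets_top_def Fpow_def)

lemma Top_in_finite_subsets_top [simp]: "top.Top \<in> finite_subsets_top \<kappa>"
  by (simp add: finite_subsets_top_def)

text \<open>A finite set of least cardinality is minimal; \<open>Top\<close> is needed as the
  minimal element only when no finite set is present.\<close>

lemma wfp_on_finite_subsets_top: "wfp_on (finite_subsets_top \<kappa>) (<)"
  unfolding wfp_on_iff_ex_minimal
proof (intro allI impI)
  fix B assume B: "B \<subseteq> finite_subsets_top \<kappa>" "B \<noteq> {}"
  show "\<exists>z\<in>B. \<forall>y. y < z \<longrightarrow> y \<notin> B"
  proof (cases "\<exists>F. top.Value F \<in> B")
    case True
    then obtain F where F: "top.Value F \<in> B"
      and least: "\<And>G. top.Value G \<in> B \<Longrightarrow> card F \<le> card G"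
      using ex_has_least_nat[where P = "\<lambda>F. top.Value F \<in> B" and m = card] by blast
    have "y \<notin> B" if "y < top.Value F" for y
    proof (cases y)
      case (Value G)
      moreover have "finite F"
        using F B by auto
      ultimately show ?thesis
        using that least[of G] psubset_card_mono[of F G] by force
    qed (use that in simp)
    then show ?thesis
      using F by blast
  next
    case False
    then have "top.Top \<in> B"
      using B by (metis ex_in_conv top.exhaust)
    then show ?thesis
      using False by (metis less_top_Top_is_Value)
  qed
qed

lemma CFPP_finite_subsets_top: "CFPP (finite_subsets_top \<kappa>) (\<le>)"
  by (rule CFPP_if_wfp_on[OF wfp_on_finite_subsets_top, of top.Top]) simp_all

subsection \<open>The selection property\<close>

text \<open>The selection takes the first available element in the order \<open>{}\<close>,
  \<open>{a}\<close>, \<open>{a, b}\<close>, \<open>{b}\<close>, \<open>Top\<close>. The case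
  \<open>a = b\<close> covers a single atom.\<close>

lemma CSP_if_two_atoms:
  assumes "Field \<kappa> = {} \<or> Field \<kappa> = {a, b}"
  shows "CSP (finite_subsets_top \<kappa>) (\<le>)"
proof -
  let ?P = "finite_subsets_top \<kappa>"
  define s where "s S = (if top.Value {} \<in> S then top.Value {}
    else if top.Value {a} \<in> S then top.Value {a}
    else if top.Value {a, b} \<in> S then top.Value {a, b}
    else if top.Value {b} \<in> S then top.Value {b} else top.Top)" for S :: "'a set top set"
  have elems: "x \<in> {top.Value {}, top.Value {a}, top.Value {a, b}, top.Value {b}, top.Top}"
    if "x \<in> ?P" for x
  proof (cases x)
    case (Value F)
    then have "F \<subseteq> {a, b}"
      using that assms by auto
    then show ?thesis
      unfolding Value Pow_iff[symmetric] Pow_insert Pow_empty by auto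
  qed simp
  have sel: "s S \<in> S" if S: "S \<in> convex_subsets ?P (\<le>)" for S
  proof -
    obtain x where "x \<in> S" "x \<in> ?P"
      using convex_subsetsD(1,2)[OF S] by blast
    then show ?thesis
      using elems[of x] unfolding s_def by auto
  qed
  \<comment> \<open>This rules out \<open>{b}\<close> being selected from a set that also contains
    \<open>Top\<close>. Such a set could dominate one with selected element \<open>{a}\<close> or
    \<open>{a, b}\<close>, and monotonicity would fail.\<close>
  have conv: "top.Value {a, b} \<in> S"
    if "S \<in> convex_subsets ?P (\<le>)" "top.Value {b} \<in> S" "top.Top \<in> S" for S
  proof -
    have "top.Value {b} \<in> ?P"
      using convex_subsetsD(2)[OF that(1)] that(2) by blast
    then have "top.Value {a, b} \<in> ?P"
      using assms by auto
    then show ?thesis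
      using convex_subsetsD(3)[OF that] by simp
  qed
  have "s X \<le> s Y" if X: "X \<in> convex_subsets ?P (\<le>)" and Y: "Y \<in> convex_subsets ?P (\<le>)"
    and XY: "bi_dominates (\<le>) X Y" for X Y
  proof -
    have XE: "x \<in> {top.Value {}, top.Value {a}, top.Value {a, b}, top.Value {b}, top.Top}"
      if "x \<in> X" for x
      using elems convex_subsetsD(2)[OF X] that by blast
    have YE: "x \<in> {top.Value {}, top.Value {a}, top.Value {a, b}, top.Value {b}, top.Top}"
      if "x \<in> Y" for x
      using elems convex_subsetsD(2)[OF Y] that by blast
    obtain y where y: "y \<in> Y" "s X \<le> y"
      using sel[OF X] XY unfolding bi_dominates_def by blast
    obtain x where x: "x \<in> X" "x \<le> s Y"
      using sel[OF Y] XY unfolding bi_dominates_def by blast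
    show ?thesis
      using x y XE[OF x(1)] YE[OF y(1)] conv[OF Y] unfolding s_def
      by (auto split: if_splits)
  qed
  then show ?thesis
    using sel unfolding CSP_def monotone_selection_def monotone_on_def by blast
qed

text \<open>
  The set \<open>{{c}, {b, c}, {a, c}}\<close> dominates both antichains, so its selected element would have
  to contain \<open>a\<close> as well as \<open>b\<close>.
\<close>

lemma no_selection_of_three_atoms:
  assumes s: "monotone_selection (\<le>) (convex_subsets (finite_subsets_top \<kappa>) (\<le>)) s"
    and abc: "{a, b, c} \<subseteq> Field \<kappa>" "a \<noteq> b" "a \<noteq> c" "b \<noteq> c"
    and sa: "s {top.Value {a}, top.Value {b}, top.Value {c}} = top.Value {a}"
    and sb: "s {top.Value {b}, top.Value {c}} = top.Value {b}"
  shows False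
proof -
  let ?P = "finite_subsets_top \<kappa>"
  let ?X = "{top.Value {a}, top.Value {b}, top.Value {c}}"
  let ?Y = "{top.Value {b}, top.Value {c}}"
  let ?Z = "{top.Value {c}, top.Value {b, c}, top.Value {a, c}}"
  have conv: "?X \<in> convex_subsets ?P (\<le>)" "?Y \<in> convex_subsets ?P (\<le>)"
    using abc unfolding convex_subsets_def
    by (auto simp: less_eq_top_def split: top.splits)
  have Z: "?Z \<in> convex_subsets ?P (\<le>)"
  proof (rule convex_subsetsI)
    fix x y z assume *: "x \<in> ?Z" "z \<in> ?Z" "y \<in> ?P" "x \<le> y" "y \<le> z"
    then obtain F where F: "y = top.Value F"
      by (cases y) auto
    with * have "c \<in> F" "F \<subseteq> {b, c} \<or> F \<subseteq> {a, c}"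
      by auto
    then have "F = {c} \<or> F = {b, c} \<or> F = {a, c}"
      by auto
    with F show "y \<in> ?Z"
      by auto
  qed (use abc in auto)
  have "bi_dominates (\<le>) ?X ?Z" "bi_dominates (\<le>) ?Y ?Z"
    unfolding bi_dominates_def by auto
  then have "top.Value {a} \<le> s ?Z" "top.Value {b} \<le> s ?Z"
    using s conv Z sa sb unfolding monotone_selection_def monotone_on_def by metis+
  moreover have "s ?Z \<in> ?Z"
    using s Z unfolding monotone_selection_def by blast
  ultimately show False
    using abc by auto
qed

text \<open>Name the atom selected from all three \<open>x\<close>, and consider the one selected
  from the remaining two. Up to renaming this is the configuration just refuted.\<close>

lemma not_CSP_if_three_atoms:
  assumes abc: "{a, b, c} \<subseteq> Field \<kappa>" "a \<noteq> b" "a \<noteq> c" "b \<noteq> c"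
  shows "\<not> CSP (finite_subsets_top \<kappa>) (\<le>)"
proof
  let ?P = "finite_subsets_top \<kappa>"
  let ?V = "top.Value :: 'a set \<Rightarrow> 'a set top"
  assume "CSP ?P (\<le>)"
  then obtain s where s: "monotone_selection (\<le>) (convex_subsets ?P (\<le>)) s"
    unfolding CSP_def by blast
  have antichain: "(\<lambda>x. ?V {x}) ` A \<in> convex_subsets ?P (\<le>)" if "A \<noteq> {}" "A \<subseteq> Field \<kappa>" for A
    using that unfolding convex_subsets_def
    by (fastforce simp: less_eq_top_def split: top.splits)
  have sel: "s ((\<lambda>x. ?V {x}) ` A) \<in> (\<lambda>x. ?V {x}) ` A" if "A \<noteq> {}" "A \<subseteq> Field \<kappa>" for A
    using s antichain[OF that] unfolding monotone_selection_def by blast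
  have pair: False
    if "s {?V {x}, ?V {y}, ?V {z}} = ?V {x}" "{x, y, z} = {a, b, c}" "x \<noteq> y" "x \<noteq> z" "y \<noteq> z" for x y z
  proof -
    have sub: "{x, y, z} \<subseteq> Field \<kappa>"
      using that(2) abc(1) by simp
    then have "s {?V {y}, ?V {z}} \<in> {?V {y}, ?V {z}}"
      using sel[of "{y, z}"] by simp
    then consider "s {?V {y}, ?V {z}} = ?V {y}" | "s {?V {z}, ?V {y}} = ?V {z}"
      by (auto simp: insert_commute)
    then show False
    proof cases
      case 1
      then show ?thesis
        using no_selection_of_three_atoms[OF s sub that(3-5,1)] by blast
    next
      case 2
      have "s {?V {x}, ?V {z}, ?V {y}} = ?V {x}"
        using that(1) by (simp add: insert_commute)
      moreover have "{x, z, y} \<subseteq> Field \<kappa>"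
        using sub by blast
      ultimately show ?thesis
        using no_selection_of_three_atoms[OF s, of x z y] 2 that(3-5) by blast
    qed
  qed
  have "s {?V {a}, ?V {b}, ?V {c}} \<in> {?V {a}, ?V {b}, ?V {c}}"
    using sel[of "{a, b, c}"] abc(1) by simp
  then consider "s {?V {a}, ?V {b}, ?V {c}} = ?V {a}" | "s {?V {b}, ?V {a}, ?V {c}} = ?V {b}"
    | "s {?V {c}, ?V {a}, ?V {b}} = ?V {c}"
    by (auto simp: insert_commute)
  then show False
    using pair[of a b c] pair[of b a c] pair[of c a b] abc by cases auto
qed

lemma CSP_finite_subsets_top_iff:
  "CSP (finite_subsets_top \<kappa>) (\<le>) \<longleftrightarrow> finite (Field \<kappa>) \<and> card (Field \<kappa>) \<le> 2"
proof
  assume csp: "CSP (finite_subsets_top \<kappa>) (\<le>)"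
  show "finite (Field \<kappa>) \<and> card (Field \<kappa>) \<le> 2"
  proof (rule ccontr)
    assume "\<not> ?thesis"
    then obtain T where "T \<subseteq> Field \<kappa>" "card T = 3"
      using obtain_subset_with_card_n[of 3 "Field \<kappa>"] infinite_arbitrarily_large[of "Field \<kappa>" 3]
      by (metis not_less_eq_eq numeral_2_eq_2 numeral_3_eq_3)
    then show False
      using not_CSP_if_three_atoms csp unfolding card_3_iff by metis
  qed
next
  assume "finite (Field \<kappa>) \<and> card (Field \<kappa>) \<le> 2"
  then have "card (Field \<kappa>) = 0 \<or> card (Field \<kappa>) = 1 \<or> card (Field \<kappa>) = 2" "finite (Field \<kappa>)"
    by linarith+
  then obtain a b where "Field \<kappa> = {} \<or> Field \<kappa> = {a, b}"
    by (metis card_0_eq card_1_singletonE card_2_iff insert_absorb2)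
  then show "CSP (finite_subsets_top \<kappa>) (\<le>)"
    by (rule CSP_if_two_atoms)
qed

subsection \<open>Selections from chains\<close>

text \<open>Comparable finite sets of equal cardinality coincide, so \<open>card\<close> injects the
  chain into the natural numbers.\<close>

lemma countable_Union_chain_of_finite_sets:
  assumes chain: "\<And>F G. F \<in> \<F> \<Longrightarrow> G \<in> \<F> \<Longrightarrow> F \<subseteq> G \<or> G \<subseteq> F" and fin: "\<And>F. F \<in> \<F> \<Longrightarrow> finite F"
  shows "countable (\<Union>\<F>)"
proof -
  have "inj_on card \<F>"
    using chain fin by (intro inj_onI) (metis card_subset_eq)
  then have "countable \<F>"
    by (rule countableI')
  then show ?thesis
    using countable_UN[of \<F> "\<lambda>F. F"] fin by (simp add: countable_finite)
qed

text \<open>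
  The set \<open>W\<close> of elements with countably many predecessors plays the role of the first
  uncountable ordinal, and the chain consists of the sets of all finite \<open>F\<close> that meet a tail of
  \<open>W\<close>.  The values of a selection form a chain of finite sets whose union is cofinal in \<open>W\<close>,
  which is impossible because that union is countable.
\<close>

lemma not_CCSP_if_uncountable:
  assumes wo: "Well_order \<kappa>" and unc: "\<not> countable (Field \<kappa>)"
  shows "\<not> CCSP (finite_subsets_top \<kappa>) (\<le>)"
proof
  let ?P = "finite_subsets_top \<kappa>"
  assume ccsp: "CCSP ?P (\<le>)"
  have wr: "wo_rel \<kappa>"
    using wo by (simp add: wo_rel_def)
  define W where "W = {x \<in> Field \<kappa>. countable (under \<kappa> x)}"
  have W: "W \<subseteq> Field \<kappa>"
    unfolding W_def by blast
  \<comment> \<open>If \<open>W\<close> were countable, the least element \<open>m\<close> outside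
    it would have all its predecessors in \<open>insert m W\<close>, hence countably many, and would
    belong to \<open>W\<close>.\<close>
  have uncW: "\<not> countable W"
  proof
    assume "countable W"
    then have ne: "Field \<kappa> - W \<noteq> {}"
      using unc W by (metis Diff_eq_empty_iff countable_subset)
    define m where "m = wo_rel.minim \<kappa> (Field \<kappa> - W)"
    have m: "m \<in> Field \<kappa> - W"
      using wo_rel.minim_in[OF wr _ ne] unfolding m_def by blast
    have "x \<in> insert m W" if "x \<in> under \<kappa> m" for x
    proof (rule ccontr)
      assume x: "x \<notin> insert m W"
      have "(x, m) \<in> \<kappa>"
        using that by (simp add: under_def)
      moreover have "(m, x) \<in> \<kappa>"
        using wo_rel.minim_least[OF wr, of "Field \<kappa> - W" x] x \<open>(x, m) \<in> \<kappa>\<close> unfolding m_def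
        by (auto intro: FieldI1)
      ultimately show False
        using wo_rel.ANTISYM[OF wr] x by (auto dest: antisymD)
    qed
    then have "countable (under \<kappa> m)"
      using \<open>countable W\<close> by (meson countable_insert countable_subset subsetI)
    then show False
      using m unfolding W_def by blast
  qed
  \<comment> \<open>\<open>Top\<close> is left out, so that a selection must return finite
    sets.\<close>
  define X where "X \<alpha> = {top.Value F | F. finite F \<and> F \<subseteq> Field \<kappa> \<and> (\<exists>\<beta>\<in>F \<inter> W. (\<alpha>, \<beta>) \<in> \<kappa>)}" for \<alpha>
  have refl: "(x, x) \<in> \<kappa>" if "x \<in> W" for x
    using wo_rel.REFL[OF wr] W that by (auto simp: refl_on_def)
  have conv: "X \<alpha> \<in> convex_subsets ?P (\<le>)" if "\<alpha> \<in> W" for \<alpha>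
  proof (rule convex_subsetsI)
    have "top.Value {\<alpha>} \<in> X \<alpha>"
      using that W refl unfolding X_def by auto
    then show "X \<alpha> \<noteq> {}"
      by blast
    show "X \<alpha> \<subseteq> ?P"
      unfolding X_def by auto
    fix x y z assume *: "x \<in> X \<alpha>" "z \<in> X \<alpha>" "y \<in> ?P" "x \<le> y" "y \<le> z"
    then obtain F where "y = top.Value F"
      unfolding X_def by (cases y) auto
    with * show "y \<in> X \<alpha>"
      unfolding X_def by auto blast
  qed
  \<comment> \<open>Upwards, adjoining \<beta> to a finite set puts it into
    \<open>X \<beta>\<close>; downwards, \<open>X \<beta>\<close> is contained in
    \<open>X \<alpha>\<close> by transitivity.\<close>
  have mono: "bi_dominates (\<le>) (X \<alpha>) (X \<beta>)" if "(\<alpha>, \<beta>) \<in> \<kappa>" "\<beta> \<in> W" for \<alpha> \<beta>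
    unfolding bi_dominates_def
  proof (intro conjI ballI)
    fix x assume "x \<in> X \<alpha>"
    then obtain F where F: "x = top.Value F" "finite F" "F \<subseteq> Field \<kappa>"
      unfolding X_def by blast
    then have "top.Value (insert \<beta> F) \<in> X \<beta>"
      using that W refl unfolding X_def by auto
    then show "\<exists>y\<in>X \<beta>. x \<le> y"
      using F by (auto intro: bexI[of _ "top.Value (insert \<beta> F)"])
  next
    fix y assume "y \<in> X \<beta>"
    then have "y \<in> X \<alpha>"
      using that wo_rel.TRANS[OF wr] unfolding X_def by (auto dest: transD)
    then show "\<exists>x\<in>X \<alpha>. x \<le> y"
      by blast
  qed
  have total: "(\<alpha>, \<beta>) \<in> \<kappa> \<or> (\<beta>, \<alpha>) \<in> \<kappa>" if "\<alpha> \<in> W" "\<beta> \<in> W" for \<alpha> \<beta>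
    using wo_rel.TOTALS[OF wr] W that by blast
  then have "Complete_Partial_Order.chain (bi_dominates (\<le>)) (X ` W)"
    using mono unfolding Complete_Partial_Order.chain_def by blast
  moreover have "X ` W \<subseteq> convex_subsets ?P (\<le>)"
    using conv by blast
  ultimately obtain s where "monotone_selection (\<le>) (X ` W) s"
    using ccsp unfolding CCSP_def by blast
  then have s: "monotone_on (X ` W) (bi_dominates (\<le>)) (\<le>) s"
    and sel: "\<And>\<alpha>. \<alpha> \<in> W \<Longrightarrow> s (X \<alpha>) \<in> X \<alpha>"
    unfolding monotone_selection_def by simp_all
  have "\<forall>\<alpha>\<in>W. \<exists>F. s (X \<alpha>) = top.Value F \<and> finite F \<and> (\<exists>\<beta>\<in>F \<inter> W. (\<alpha>, \<beta>) \<in> \<kappa>)"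
    using sel unfolding X_def by blast
  then obtain F where F: "\<And>\<alpha>. \<alpha> \<in> W \<Longrightarrow> s (X \<alpha>) = top.Value (F \<alpha>)"
    "\<And>\<alpha>. \<alpha> \<in> W \<Longrightarrow> finite (F \<alpha>)"
    "\<And>\<alpha>. \<alpha> \<in> W \<Longrightarrow> \<exists>\<beta>\<in>F \<alpha> \<inter> W. (\<alpha>, \<beta>) \<in> \<kappa>"
    by metis
  have "F \<alpha> \<subseteq> F \<beta>" if "\<alpha> \<in> W" "\<beta> \<in> W" "(\<alpha>, \<beta>) \<in> \<kappa>" for \<alpha> \<beta>
  proof -
    have "s (X \<alpha>) \<le> s (X \<beta>)"
      using monotone_onD[OF s] mono that by blast
    then show ?thesis
      using F(1) that by simp
  qed
  then have "countable (\<Union>(F ` W))"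
    using total F(2) by (intro countable_Union_chain_of_finite_sets) blast+
  \<comment> \<open>Each initial segment below an element of \<open>W\<close> is countable, and
    these segments cover \<open>W\<close> because \<open>F \<alpha>\<close> meets the tail of
    \<alpha>.\<close>
  then have "countable (\<Union>\<beta>\<in>\<Union>(F ` W) \<inter> W. under \<kappa> \<beta>)"
    unfolding W_def by auto
  moreover have "W \<subseteq> (\<Union>\<beta>\<in>\<Union>(F ` W) \<inter> W. under \<kappa> \<beta>)"
    using F(3) unfolding under_def by fastforce
  ultimately show False
    using uncW countable_subset by blast
qed

subsection \<open>Fixed points in the poset of convex subsets\<close>

text \<open>There are finitely many convex sets, and the singleton of the empty set is the least of
  them.\<close>

lemma FPP_convex_subsets_if_finite:
  assumes "finite (Field \<kappa>)"
  shows "FPP (convex_subsets (finite_subsets_top \<kappa>) (\<le>)) (bi_dominates (\<le>))"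
proof (rule FPP_if_finite_bot)
  let ?P = "finite_subsets_top \<kappa>"
  have least: "top.Value {} \<le> x" for x :: "'a set top"
    by (cases x) auto
  have "finite ?P"
    using assms unfolding finite_subsets_top_def Fpow_def by simp
  moreover have "convex_subsets ?P (\<le>) \<subseteq> Pow ?P"
    by (auto dest: convex_subsetsD)
  ultimately show "finite (convex_subsets ?P (\<le>))"
    using finite_subset by blast
  show "{top.Value {}} \<in> convex_subsets ?P (\<le>)"
    unfolding convex_subsets_def by auto
  show "bi_dominates (\<le>) {top.Value {}} X" if "X \<in> convex_subsets ?P (\<le>)" for X
    using convex_subsetsD(1)[OF that] least unfolding bi_dominates_def by blast
  show "X = Y" if "X \<in> convex_subsets ?P (\<le>)" "Y \<in> convex_subsets ?P (\<le>)"
    "bi_dominates (\<le>) X Y" "bi_dominates (\<le>) Y X" for X Y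
    using bi_dominates_antisym that .
qed (blast intro: bi_dominates_refl bi_dominates_trans)+

text \<open>
  In the gap below, a set \<open>Z\<close> between all \<open>X n\<close> and all \<open>Y m\<close> has a finite element \<open>F\<close>
  containing \<open>r 0\<close>.  As \<open>F\<close> cannot contain every \<open>r i\<close>, it contains some \<open>t k\<close>, but
  then \<open>F\<close> is below no element of \<open>Y (Suc k)\<close>.
\<close>

lemma not_FPP_convex_subsets_if_infinite:
  assumes "infinite (Field \<kappa>)"
  shows "\<not> FPP (convex_subsets (finite_subsets_top \<kappa>) (\<le>)) (bi_dominates (\<le>))"
proof -
  let ?P = "finite_subsets_top \<kappa>"
  obtain e :: "nat \<Rightarrow> 'a" where e: "inj e" "range e \<subseteq> Field \<kappa>"
    using infinite_countable_subset[OF assms] by blast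
  \<comment> \<open>Even and odd indices split an infinite sequence of distinct elements into two
    disjoint ones.\<close>
  define r where "r n = e (2 * n)" for n
  define t where "t n = e (Suc (2 * n))" for n
  have eq: "r i = r j \<longleftrightarrow> i = j" "t i = t j \<longleftrightarrow> i = j" "r i \<noteq> t j" "t i \<noteq> r j" for i j
    using e(1) unfolding r_def t_def by (simp_all add: inj_eq) presburger+
  have rt: "r i \<in> Field \<kappa>" "t i \<in> Field \<kappa>" for i
    using e(2) unfolding r_def t_def by auto
  \<comment> \<open>These singletons lie in every \<open>X n\<close> and \<open>Y m\<close>. Since
    each element of \<open>Y m\<close> is above one of them, they settle the downward half of all
    the dominations below.\<close>
  define T where "T = (\<lambda>k. top.Value {t k}) ` UNIV"
  define X where "X n = insert (top.Value (r ` {..n})) T" for n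
  define Y where "Y m = T \<union> {top.Value (insert (t k) F) | k F. m \<le> k \<and> finite F \<and> F \<subseteq> range r}" for m
  have T: "top.Value {t k} \<in> T" for k
    unfolding T_def by blast
  have TX: "T \<subseteq> X n" and TY: "T \<subseteq> Y n" for n
    unfolding X_def Y_def by auto
  have X_conv: "X n \<in> convex_subsets ?P (\<le>)" for n
  proof (rule convex_subsetsI)
    fix x y z assume *: "x \<in> X n" "z \<in> X n" "y \<in> ?P" "x \<le> y" "y \<le> z"
    have "x \<le> z"
      using *(4,5) by (rule order_trans)
    \<comment> \<open>\<open>X n\<close> is an antichain, so a point between two of its elements
      equals both.\<close>
    moreover have "\<not> r ` {..n} \<subseteq> {t k}" "t k \<notin> r ` {..n}" for k
      using eq by auto
    ultimately have "x = z"
      using *(1,2) eq unfolding X_def T_def by auto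
    with * show "y \<in> X n"
      using order_antisym by metis
  qed (use rt in \<open>auto simp: X_def T_def\<close>)
  have Y_above: "\<exists>k. top.Value {t k} \<le> y" if "y \<in> Y m" for y m
    using that unfolding Y_def T_def by auto
  have Y_conv: "Y m \<in> convex_subsets ?P (\<le>)" for m
  proof (rule convex_subsetsI)
    show "Y m \<noteq> {}"
      using T TY by blast
    show "Y m \<subseteq> ?P"
    proof -
      have "range r \<subseteq> Field \<kappa>"
        using rt by blast
      then show ?thesis
        using rt unfolding Y_def T_def by auto
    qed
    fix x y z assume *: "x \<in> Y m" "z \<in> Y m" "y \<in> ?P" "x \<le> y" "y \<le> z"
    obtain j where j: "top.Value {t j} \<le> y"
      using Y_above[OF *(1)] *(4) order_trans by blast
    obtain F where F: "y = top.Value F"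
      using *(2,5) unfolding Y_def T_def by (cases y) auto
    consider k where "z = top.Value {t k}"
      | k G where "z = top.Value (insert (t k) G)" "m \<le> k" "finite G" "G \<subseteq> range r"
      using *(2) unfolding Y_def T_def by blast
    then show "y \<in> Y m"
    proof cases
      case 1
      then have "F = {t k}"
        using F j *(5) by auto
      then show ?thesis
        using F T TY by blast
    next
      case 2
      \<comment> \<open>The only \<open>t\<close> in the upper bound is \<open>t k\<close>, so
        \<open>F\<close> consists of \<open>t k\<close> and finitely many values of
        \<open>r\<close>, with the same index \<open>k\<close>.\<close>
      then have "t j \<in> F" "F \<subseteq> insert (t k) G"
        using F j *(5) by auto
      moreover from this have "t j \<in> insert (t k) (range r)"
        using 2(4) by blast
      then have "j = k"
        using eq by auto
      ultimately have "F = insert (t k) (F - {t k})" "finite (F - {t k})" "F - {t k} \<subseteq> range r"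
        using 2 finite_subset[of "F - {t k}" G] by auto
      then show ?thesis
        using F 2(2) unfolding Y_def by blast
    qed
  qed
  show ?thesis
  proof (rule not_FPP_if_gap[where X = X and Y = Y])
    show "bi_dominates (\<le>) (X m) (X n)" if "m \<le> n" for m n
      using that unfolding bi_dominates_def X_def by (auto simp: image_mono)
    have Y_mono: "Y n \<subseteq> Y m" if "m \<le> n" for m n
      using that unfolding Y_def by (blast intro: order_trans)
    show "bi_dominates (\<le>) (Y n) (Y m)" if "m \<le> n" for m n
      unfolding bi_dominates_def
    proof (intro conjI ballI)
      show "\<exists>y\<in>Y m. x \<le> y" if "x \<in> Y n" for x
        using that Y_mono[OF \<open>m \<le> n\<close>] by blast
      show "\<exists>x\<in>Y n. x \<le> y" if "y \<in> Y m" for y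
        using Y_above[OF that] T TY by blast
    qed
    show "bi_dominates (\<le>) (X m) (Y n)" for m n
      unfolding bi_dominates_def
    proof (intro conjI ballI)
      fix x assume "x \<in> X m"
      moreover have "top.Value (insert (t n) (r ` {..m})) \<in> Y n"
        unfolding Y_def by blast
      moreover have "top.Value (r ` {..m}) \<le> top.Value (insert (t n) (r ` {..m}))"
        by auto
      ultimately show "\<exists>y\<in>Y n. x \<le> y"
        using TY unfolding X_def by blast
    next
      show "\<exists>x\<in>X m. x \<le> y" if "y \<in> Y n" for y
        using Y_above[OF that] T TX by blast
    qed
    fix Z assume "Z \<in> convex_subsets ?P (\<le>)"
      and XZ: "\<And>n. bi_dominates (\<le>) (X n) Z" and ZY: "\<And>n. bi_dominates (\<le>) Z (Y n)"
    obtain z where z: "z \<in> Z" "top.Value (r ` {..0}) \<le> z"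
      using XZ[of 0] unfolding bi_dominates_def X_def by blast
    \<comment> \<open>The alternative \<open>F = {}\<close> accounts for the elements of
      \<open>T\<close>, whose index need not reach \<open>n\<close>.\<close>
    have below: "\<exists>k F. z \<le> top.Value (insert (t k) F) \<and> (F = {} \<or> n \<le> k) \<and> finite F \<and> F \<subseteq> range r" for n
    proof -
      obtain y where "y \<in> Y n" "z \<le> y"
        using ZY z(1) unfolding bi_dominates_def by blast
      then show ?thesis
        unfolding Y_def T_def by blast
    qed
    \<comment> \<open>A finite upper bound shows that \<open>z\<close> is not
      \<open>Top\<close>.\<close>
    then obtain H where H: "z \<le> top.Value H" "finite H"
      by (meson finite_insert)
    then obtain F where F: "z = top.Value F" "finite F"
      by (cases z) (auto intro: finite_subset)
    have "\<exists>k. t k \<in> F"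
    proof (rule ccontr)
      assume no: "\<nexists>k. t k \<in> F"
      \<comment> \<open>Without any \<open>t k\<close> in \<open>F\<close>, the element of
        \<open>X n\<close> below \<open>z\<close> cannot come from \<open>T\<close>, so it is the
        initial segment of \<open>r\<close>.\<close>
      have "r n \<in> F" for n
      proof -
        obtain x where "x \<in> X n" "x \<le> z"
          using XZ z(1) unfolding bi_dominates_def by blast
        then show ?thesis
          using F no unfolding X_def T_def by (auto simp: image_subset_iff)
      qed
      then have "range r \<subseteq> F"
        by blast
      moreover have "infinite (range r)"
        using eq by (intro range_inj_infinite) (simp add: inj_def)
      ultimately show False
        using F finite_subset by blast
    qed
    then obtain k where k: "t k \<in> F"
      by blast
    \<comment> \<open>The index \<open>Suc k\<close> is chosen to clash with \<open>k = l\<close>.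
      Only \<open>G = {}\<close> remains, which leaves no room for \<open>r 0\<close>.\<close>
    obtain l G where l: "F \<subseteq> insert (t l) G" "G = {} \<or> Suc k \<le> l" "G \<subseteq> range r"
      using below[of "Suc k"] F by auto
    have "t k \<in> insert (t l) (range r)"
      using k l by blast
    then have "k = l"
      using eq by auto
    then have "F \<subseteq> {t l}"
      using l by auto
    moreover have "r 0 \<in> F"
      using z F by simp
    ultimately show False
      using eq by auto
  qed (use X_conv Y_conv in \<open>auto intro: bi_dominates_refl bi_dominates_trans\<close>)
qed

section \<open>Translation between cardinal comparisons and the size of the field\<close>

text \<open>Both orders are replaced by the cardinals of their fields, which reduces the comparison
  to an injection into \<open>{x. x < n}\<close>.\<close>

lemma Card_order_ordLeq_natLeq_on_iff:
  assumes "Card_order \<kappa>"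
  shows "\<kappa> \<le>o natLeq_on n \<longleftrightarrow> finite (Field \<kappa>) \<and> card (Field \<kappa>) \<le> n"
proof -
  have "natLeq_on n =o |{x. x < n}|"
    using natLeq_on_well_order_on[of n] card_of_well_order_on[of "{x. x < n}"]
    by (intro finite_well_order_on_ordIso) simp_all
  moreover have "|Field \<kappa>| =o \<kappa>"
    using assms by (rule card_of_Field_ordIso)
  ultimately have "\<kappa> \<le>o natLeq_on n \<longleftrightarrow> |Field \<kappa>| \<le>o |{x. x < n}|"
    by (meson ordIso_ordLeq_trans ordIso_symmetric ordLeq_ordIso_trans)
  also have "\<dots> \<longleftrightarrow> (\<exists>f. inj_on f (Field \<kappa>) \<and> f ` Field \<kappa> \<subseteq> {x. x < n})"
    by (simp add: card_of_ordLeq)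
  also have "\<dots> \<longleftrightarrow> finite (Field \<kappa>) \<and> card (Field \<kappa>) \<le> n"
    using inj_on_finite[of _ "Field \<kappa>" "{x. x < n}"] card_inj_on_le[of _ "Field \<kappa>" "{x. x < n}"]
      card_le_inj[of "Field \<kappa>" "{x. x < n}"]
    by auto
  finally show ?thesis .
qed

theorem mainTheorem5:
  fixes \<kappa> :: "'a rel" and P :: "'a set top set"
  assumes "Card_order \<kappa>"
    and "P = finite_subsets_top \<kappa>"
  shows "CFPP P (\<le>)
    \<and> (CSP P (\<le>) \<longleftrightarrow> \<kappa> \<le>o natLeq_on 2)
    \<and> (natLeq <o \<kappa> \<longrightarrow> \<not> CCSP P (\<le>))
    \<and> (FPP (convex_subsets P (\<le>)) (bi_dominates (\<le>)) \<longleftrightarrow> \<kappa> <o natLeq)"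
proof -
  have iso: "|Field \<kappa>| =o \<kappa>"
    using assms(1) by (rule card_of_Field_ordIso)
  have wo: "Well_order \<kappa>"
    using assms(1) by (simp add: card_order_on_def)
  have "\<not> countable (Field \<kappa>)" if "natLeq <o \<kappa>"
    using that iso unfolding countable_card_le_natLeq
    by (meson not_ordLess_ordLeq ordIso_symmetric ordLess_ordIso_trans)
  moreover have "finite (Field \<kappa>) \<longleftrightarrow> \<kappa> <o natLeq"
    using iso unfolding finite_iff_ordLess_natLeq
    by (meson ordIso_ordLess_trans ordIso_symmetric)
  ultimately show ?thesis
    using CFPP_finite_subsets_top[of \<kappa>] CSP_finite_subsets_top_iff[of \<kappa>]
      Card_order_ordLeq_natLeq_on_iff[OF assms(1)] not_CCSP_if_uncountable[OF wo]
      FPP_convex_subsets_if_finite[of \<kappa>] not_FPP_convex_subsets_if_infinite[of \<kappa>]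
    by (auto simp: assms(2))
qed

end
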